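(* Let $x_n:=q^n$ for $n\in\mathbb{N}$. Then the series $\sum_{n=1}^{\infty}x_n$ has (i) property (A) for $q\in\left(0,\frac{2-\sqrt{2}}{2}\right)$; (ii) property (B) for $q\in\left(0,\frac{3-\sqrt{5}}{2}\right)$.
   Context: For a convergent series $\sum_{n=1}^\infty x_n$ of positive terms put $r_n=\sum_{k=n+1}^{\infty}x_k$ for $n\ge 0$. The series has property (A) if $x_i>\sum_{n=i+1}^{\infty}(x_n+r_{n-1})$ for each $i\in\mathbb{N}=\{1,2,\dots\}$, and property (B) if $r_{i-1}>\sum_{n=i+1}^{\infty}(x_n+r_{n-1})$ for each $i\in\mathbb{N}$. *)

theory Defs
  imports Complex_Main
begin

text \<open>A series \<open>x 1 + x 2 + \<dots>\<close> is given by its terms \<open>x :: nat \<Rightarrow> real\<close>; the value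
  \<open>x 0\<close> is irrelevant throughout.\<close>

definition convergent_positive_series :: "(nat \<Rightarrow> real) \<Rightarrow> bool" where
  "convergent_positive_series x \<longleftrightarrow> (\<forall>n\<ge>1. 0 < x n) \<and> summable (\<lambda>k. x (k + 1))"

definition remainder :: "(nat \<Rightarrow> real) \<Rightarrow> nat \<Rightarrow> real" where
  "remainder x n = (\<Sum>k. x (k + (n + 1)))"

text \<open>The terms \<open>x n + r (n - 1)\<close> of the series on the right-hand sides of (A) and (B); only
  used for \<open>n \<ge> 2\<close>.\<close>

definition aux_term :: "(nat \<Rightarrow> real) \<Rightarrow> nat \<Rightarrow> real" where
  "aux_term x n = x n + remainder x (n - 1)"

text \<open>Since \<open>suminf\<close> has an unspecified value on divergent series, convergence of the series
  on the right-hand side is required explicitly; as its terms are positive, a divergent one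
  has sum \<open>\<infinity>\<close> and the strict inequality fails.\<close>

definition property_A :: "(nat \<Rightarrow> real) \<Rightarrow> bool" where
  "property_A x \<longleftrightarrow> convergent_positive_series x \<and>
     (\<forall>i\<ge>1. summable (\<lambda>n. aux_term x (n + (i + 1))) \<and>
             x i > (\<Sum>n. aux_term x (n + (i + 1))))"

definition property_B :: "(nat \<Rightarrow> real) \<Rightarrow> bool" where
  "property_B x \<longleftrightarrow> convergent_positive_series x \<and>
     (\<forall>i\<ge>1. summable (\<lambda>n. aux_term x (n + (i + 1))) \<and>
             remainder x (i - 1) > (\<Sum>n. aux_term x (n + (i + 1))))"

end

theory Submission
  imports Defs
begin

text \<open>For \<open>x n = q ^ n\<close> every series involved is geometric: \<open>r n = q ^ (n + 1) / (1 - q)\<close>, and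
  the right-hand side of (A) and (B) is \<open>q ^ (i + 1) * (2 - q) / (1 - q)\<^sup>2\<close>. Hence (A) reduces to
  \<open>2 * q\<^sup>2 - 4 * q + 1 > 0\<close> and (B) to \<open>q\<^sup>2 - 3 * q + 1 > 0\<close>; the bounds on \<open>q\<close> are
  the smaller roots of these quadratics.\<close>

lemma geometric_tail_sums:
  fixes q :: real
  assumes "0 < q" "q < 1"
  shows "(\<lambda>k. q ^ (k + m)) sums (q ^ m / (1 - q))"
  using sums_mult2[OF geometric_sums[of q], of "q ^ m"] assms
  by (simp add: power_add)

lemma remainder_geometric:
  fixes q :: real
  assumes "0 < q" "q < 1"
  shows "remainder (\<lambda>n. q ^ n) n = q ^ (n + 1) / (1 - q)"
  unfolding remainder_def using sums_unique[OF geometric_tail_sums[OF assms]] by metis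

text \<open>The tail \<open>remainder\<close> at \<open>n - 1\<close> starts with
  \<open>q ^ n\<close> itself, so \<open>q ^ n\<close> factors out. The bound
  \<open>1 \<le> n\<close> keeps the truncated subtraction \<open>n - 1\<close> exact.\<close>

lemma aux_term_geometric:
  fixes q :: real
  assumes "0 < q" "q < 1" "1 \<le> n"
  shows "aux_term (\<lambda>n. q ^ n) n = q ^ n * ((2 - q) / (1 - q))"
  using assms by (simp add: aux_term_def remainder_geometric field_simps flip: power_Suc)

text \<open>The sum is again geometric. Its factor \<open>q ^ i\<close> is split off because
  \<open>x i\<close> and \<open>remainder x (i - 1)\<close> carry it too.\<close>

lemma aux_term_geometric_sums:
  fixes q :: real
  assumes "0 < q" "q < 1"
  shows "(\<lambda>n. aux_term (\<lambda>n. q ^ n) (n + (i + 1))) sums (q ^ i * (q * (2 - q) / (1 - q)\<^sup>2))"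
proof -
  have "(\<lambda>n. q ^ (n + (i + 1)) * ((2 - q) / (1 - q)))
          sums (q ^ (i + 1) / (1 - q) * ((2 - q) / (1 - q)))"
    by (rule sums_mult2[OF geometric_tail_sums[OF assms]])
  moreover have "q ^ (i + 1) / (1 - q) * ((2 - q) / (1 - q)) = q ^ i * (q * (2 - q) / (1 - q)\<^sup>2)"
    by (simp add: power2_eq_square)
  ultimately show ?thesis
    using assms by (simp add: aux_term_geometric)
qed

lemma convergent_positive_series_geometric:
  fixes q :: real
  assumes "0 < q" "q < 1"
  shows "convergent_positive_series (\<lambda>n. q ^ n)"
  unfolding convergent_positive_series_def
  using assms sums_summable[OF geometric_tail_sums[OF assms]] by simp

text \<open>Cancelling \<open>q ^ i > 0\<close> in (A) leaves one inequality independent of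
  \<open>i\<close>.\<close>

lemma property_A_geometric:
  fixes q :: real
  assumes "0 < q" "q < 1" "q * (2 - q) < (1 - q)\<^sup>2"
  shows "property_A (\<lambda>n. q ^ n)"
proof -
  have "q * (2 - q) / (1 - q)\<^sup>2 < 1"
    using assms by simp
  then have "q ^ i * (q * (2 - q) / (1 - q)\<^sup>2) < q ^ i" for i
    using mult_strict_left_mono[of "q * (2 - q) / (1 - q)\<^sup>2" 1 "q ^ i"] assms(1) by simp
  then show ?thesis
    using convergent_positive_series_geometric[OF assms(1,2)]
      aux_term_geometric_sums[OF assms(1,2)]
    unfolding property_A_def sums_iff by simp
qed

text \<open>Here the left-hand side is \<open>q ^ i / (1 - q)\<close>, so after cancelling
  \<open>q ^ i\<close> one factor \<open>1 - q\<close> cancels as well.\<close>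

lemma property_B_geometric:
  fixes q :: real
  assumes "0 < q" "q < 1" "q * (2 - q) < 1 - q"
  shows "property_B (\<lambda>n. q ^ n)"
proof -
  have "q * (2 - q) / (1 - q)\<^sup>2 < (1 - q) / (1 - q)\<^sup>2"
    using assms by (intro divide_strict_right_mono) auto
  also have "\<dots> = 1 / (1 - q)"
    by (simp add: power2_eq_square)
  finally have "q * (2 - q) / (1 - q)\<^sup>2 < 1 / (1 - q)" .
  then have "q ^ i * (q * (2 - q) / (1 - q)\<^sup>2) < q ^ i / (1 - q)" for i
    using mult_strict_left_mono[of "q * (2 - q) / (1 - q)\<^sup>2" "1 / (1 - q)" "q ^ i"] assms(1)
    by simp
  moreover have "remainder (\<lambda>n. q ^ n) (i - 1) = q ^ i / (1 - q)" if "1 \<le> i" for i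
    using that assms by (simp add: remainder_geometric flip: power_Suc)
  ultimately show ?thesis
    using convergent_positive_series_geometric[OF assms(1,2)]
      aux_term_geometric_sums[OF assms(1,2)]
    unfolding property_B_def sums_iff by simp
qed

theorem proposition2p3:
  fixes q :: real
  shows "(q \<in> {0<..<(2 - sqrt 2) / 2} \<longrightarrow> property_A (\<lambda>n. q ^ n)) \<and>
         (q \<in> {0<..<(3 - sqrt 5) / 2} \<longrightarrow> property_B (\<lambda>n. q ^ n))"
proof (intro conjI impI)
  assume "q \<in> {0<..<(2 - sqrt 2) / 2}"
  then have q: "0 < q" "sqrt 2 < 2 - 2 * q"
    by auto
  moreover have "1 < sqrt (2 :: real)"
    by simp
  ultimately have "q < 1"
    by linarith
  \<comment> \<open>Completed square:
    \<open>(2 - 2 * q)\<^sup>2 - 2 = 2 * (2 * q\<^sup>2 - 4 * q + 1)\<close>.\<close>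
  moreover have "2 < (2 - 2 * q)\<^sup>2"
    using q(2) by (metis not_less real_le_rsqrt)
  then have "q * (2 - q) < (1 - q)\<^sup>2"
    by (simp add: power2_eq_square algebra_simps)
  ultimately show "property_A (\<lambda>n. q ^ n)"
    using q(1) by (intro property_A_geometric)
next
  assume "q \<in> {0<..<(3 - sqrt 5) / 2}"
  then have q: "0 < q" "sqrt 5 < 3 - 2 * q"
    by auto
  \<comment> \<open>This gives \<open>1 < 3 - 2 * q\<close>, which is exactly
    \<open>q < 1\<close>.\<close>
  moreover have "1 < sqrt (5 :: real)"
    by simp
  ultimately have "q < 1"
    by linarith
  \<comment> \<open>Completed square:
    \<open>(3 - 2 * q)\<^sup>2 - 5 = 4 * (q\<^sup>2 - 3 * q + 1)\<close>.\<close>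
  moreover have "5 < (3 - 2 * q)\<^sup>2"
    using q(2) by (metis not_less real_le_rsqrt)
  then have "q * (2 - q) < 1 - q"
    by (simp add: power2_eq_square algebra_simps)
  ultimately show "property_B (\<lambda>n. q ^ n)"
    using q(1) by (intro property_B_geometric)
qed

end
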